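(* Fix a positive integer $n$, a nonzero $n$-partition $\lambda$ with $\lambda_n=0$, and an $n$-semistandard tableau $T$ of shape $\lambda$. Let $\pi_T$ be the final permutation produced by the greedy (alcove model) procedure applied to $T$, and let $\sigma_T$ be the permutation associated with the scanning tableau $S(T)$ of $T$ (both defined in the context). Then $\pi_T=\sigma_T$.
   Context: Let $\lambda=(\lambda_1,\dots,\lambda_n)$ be weakly decreasing nonnegative integers with $\lambda_n=0$, $\lambda\neq 0$, identified with its Young diagram ($\lambda_i$ left-justified boxes in row $i$). For $1\le j\le\lambda_1$ let $c_j$ be the length of column $j$. Let $\zeta_1<\dots<\zeta_d$ be the distinct column lengths, $\zeta_0:=0$, $\zeta_{d+1}:=n$. Write $(j,i)$ for the box in column $j$, row $i$ ($1\le i\le c_j$). Reading order: $(l,k)\le(j,i)$ iff $l<j$, or $l=j$ and $k\ge i$ (columns left to right, each column bottom to top). Convention: $(j,c_j+1)$ means $(j-1,1)$. An $n$-semistandard tableau $T$ of shape $\lambda$ is a filling with entries in $[n]=\{1,\dots,n\}$, weakly increasing along rows and strictly increasing down columns; $T(j,i)$ is its entry at $(j,i)$ and $C_j$ its $j$-th column. A key is a tableau in which every value of $C_j$ also appears in $C_{j-1}$ for $1<j\le\lambda_1$. Permutations in $S_n$ are written in one-line form $(\phi_1,\dots,\phi_n)$. $S_n^\lambda$ is the set of $\phi\in S_n$ with $\phi_{\zeta_{h-1}+1}<\dots<\phi_{\zeta_h}$ for $1\le h\le d+1$. Scanning tableau: The EWIS of a finite sequence $x_1,x_2,\dots$ is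 $x_{a_1},x_{a_2},\dots$ with $a_1=1$ and $a_b$ the smallest index $>a_{b-1}$ with $x_{a_b}\ge x_{a_{b-1}}$ (stopping when none exists). For each column $j$ and for $i=c_j,c_j-1,\dots,1$ in turn: delete from $T$ and $\lambda$ the boxes of the previously computed paths $P(T;j,k)$, $k>i$ (this leaves a semistandard tableau of a valid shape); form the sequence of entries in the lowest box of each of the columns $j,j+1,\dots,\lambda_1$ of the current shape (skipping empty columns); the scanning path $P(T;j,i)$ is the set of locations of the terms of its EWIS (its first location is $(j,i)$). The scanning tableau $S(T)$ has shape $\lambda$ and entry at $(j,i)$ equal to $T$ at the last location (in reading order) of $P(T;j,i)$; $S(T)$ is a key. Define $\sigma_T$ by: for $1\le h\le d$, $\sigma_{\zeta_{h-1}+1},\dots,\sigma_{\zeta_h}$ are the values in the columns of length $\zeta_h$ of $S(T)$ that are not in the columns of length $\zeta_{h-1}$ (all values for $h=1$), in increasing order; and $\sigma_{\zeta_d+1},\dots,\sigma_n$ are the values of $[n]$ not in the first column of $S(T)$, in increasing order. Greedy procedure: $\pi^{(1,1)}$ has as first $c_1$ entries the entries of $C_1$ in increasing order, followed by the remaining elements of $[n]$ in increasing order. For locations $(j,i)$ with $j\ge 2$, taken in reading order from $(2,c_2)$ to $(\lambda_1,1)$, define $\pi^{(j,i)}$ from its predecessor $\pi:=\pi^{(j,i+1)}$. If $T(j-1,i)=T(j,i)$, set $\pi^{(j,i)}=\pi$. Otherwise (then $\pi_i=T(j-1,i)$ and $T(j,i)=\pi_k$ for some $k>c_j$): let $i_0=i$;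 given $i_{x-1}$ with $\pi_{i_{x-1}}<T(j,i)$, let $i_x$ be the smallest index $>c_j$ with $\pi_{i_{x-1}}<\pi_{i_x}\le T(j,i)$; stop at $i_m$ with $\pi_{i_m}=T(j,i)$. Set $\pi^{(j,i)}_{i_x}=\pi_{i_{x-1}}$ for $1\le x\le m$, $\pi^{(j,i)}_{i_0}=\pi_{i_m}$, and all other entries equal to those of $\pi$. Finally $\pi_T:=\pi^{(\lambda_1,1)}$. *)

theory Defs
  imports Main
begin

text \<open>Conventions. A partition is a function lam :: nat => nat, where lam i is the
length of row i for 1 <= i <= n. A tableau T :: nat => nat => nat gives the entry
T j i in column j, row i (box (j,i)). Permutations of [n] are lists of length n in
one-line form (position p of the list, 0-indexed, holds phi_(p+1)).\<close>

definition is_npartition :: "nat \<Rightarrow> (nat \<Rightarrow> nat) \<Rightarrow> bool" where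
  "is_npartition n lam \<longleftrightarrow> (\<forall>i. 1 \<le> i \<and> i < n \<longrightarrow> lam (Suc i) \<le> lam i)"

definition boxes :: "nat \<Rightarrow> (nat \<Rightarrow> nat) \<Rightarrow> (nat \<times> nat) set" where
  "boxes n lam = {(j, i). 1 \<le> i \<and> i \<le> n \<and> 1 \<le> j \<and> j \<le> lam i}"

definition colLen :: "nat \<Rightarrow> (nat \<Rightarrow> nat) \<Rightarrow> nat \<Rightarrow> nat" where
  "colLen n lam j = card {i \<in> {1..n}. j \<le> lam i}"

definition semistandard :: "nat \<Rightarrow> (nat \<Rightarrow> nat) \<Rightarrow> (nat \<Rightarrow> nat \<Rightarrow> nat) \<Rightarrow> bool" where
  "semistandard n lam T \<longleftrightarrow>
     (\<forall>(j, i) \<in> boxes n lam. T j i \<in> {1..n}) \<and>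
     (\<forall>(j, i) \<in> boxes n lam. (Suc j, i) \<in> boxes n lam \<longrightarrow> T j i \<le> T (Suc j) i) \<and>
     (\<forall>(j, i) \<in> boxes n lam. (j, Suc i) \<in> boxes n lam \<longrightarrow> T j i < T j (Suc i))"

definition colSet :: "nat \<Rightarrow> (nat \<Rightarrow> nat) \<Rightarrow> (nat \<Rightarrow> nat \<Rightarrow> nat) \<Rightarrow> nat \<Rightarrow> nat set" where
  "colSet n lam T j = {T j i | i. 1 \<le> i \<and> i \<le> colLen n lam j}"

fun ewis_aux :: "nat \<Rightarrow> ('b \<times> nat) list \<Rightarrow> 'b list" where
  "ewis_aux v [] = []"
| "ewis_aux v ((b, x) # xs) = (if v \<le> x then b # ewis_aux x xs else ewis_aux v xs)"

fun ewis :: "('b \<times> nat) list \<Rightarrow> 'b list" where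
  "ewis [] = []"
| "ewis ((b, x) # xs) = b # ewis_aux x xs"

definition scan_path ::
  "(nat \<Rightarrow> nat) \<Rightarrow> (nat \<Rightarrow> nat \<Rightarrow> nat) \<Rightarrow> nat \<Rightarrow> (nat \<times> nat) set \<Rightarrow> (nat \<times> nat) list" where
  "scan_path lam T j D =
     ewis [ ((l, Max {i. (l, i) \<in> D}), T l (Max {i. (l, i) \<in> D})).
            l \<leftarrow> [j..<Suc (lam 1)], {i. (l, i) \<in> D} \<noteq> {} ]"

text \<open>The paths P(T;j,c_j), P(T;j,c_j - 1), ..., P(T;j,1), computed in turn,
  deleting the boxes of previously computed paths.\<close>
fun col_paths ::
  "(nat \<Rightarrow> nat) \<Rightarrow> (nat \<Rightarrow> nat \<Rightarrow> nat) \<Rightarrow> nat \<Rightarrow> nat \<Rightarrow> (nat \<times> nat) set \<Rightarrow> (nat \<times> nat) list list" where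
  "col_paths lam T j 0 D = []"
| "col_paths lam T j (Suc m) D =
     (let p = scan_path lam T j D in p # col_paths lam T j m (D - set p))"

definition scanning_path ::
  "nat \<Rightarrow> (nat \<Rightarrow> nat) \<Rightarrow> (nat \<Rightarrow> nat \<Rightarrow> nat) \<Rightarrow> nat \<Rightarrow> nat \<Rightarrow> (nat \<times> nat) list" where
  "scanning_path n lam T j i =
     col_paths lam T j (colLen n lam j) (boxes n lam) ! (colLen n lam j - i)"

text \<open>Scanning tableau S(T): entry at (j,i) is T at the last location (in reading order)
  of P(T;j,i); the locations of a path lie in strictly increasing columns, so this is the
  last element of the list.\<close>
definition scanning_tableau ::
  "nat \<Rightarrow> (nat \<Rightarrow> nat) \<Rightarrow> (nat \<Rightarrow> nat \<Rightarrow> nat) \<Rightarrow> nat \<Rightarrow> nat \<Rightarrow> nat" where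
  "scanning_tableau n lam T j i = (case last (scanning_path n lam T j i) of (l, k) \<Rightarrow> T l k)"

definition zetas :: "nat \<Rightarrow> (nat \<Rightarrow> nat) \<Rightarrow> nat list" where
  "zetas n lam = sorted_list_of_set {colLen n lam j | j. 1 \<le> j \<and> j \<le> lam 1}"

definition zeta :: "nat \<Rightarrow> (nat \<Rightarrow> nat) \<Rightarrow> nat \<Rightarrow> nat" where
  "zeta n lam h = (if h = 0 then 0 else zetas n lam ! (h - 1))"

definition vals_of_len ::
  "nat \<Rightarrow> (nat \<Rightarrow> nat) \<Rightarrow> (nat \<Rightarrow> nat \<Rightarrow> nat) \<Rightarrow> nat \<Rightarrow> nat set" where
  "vals_of_len n lam S z = (\<Union>j \<in> {j. 1 \<le> j \<and> j \<le> lam 1 \<and> colLen n lam j = z}. colSet n lam S j)"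

definition sigma_T :: "nat \<Rightarrow> (nat \<Rightarrow> nat) \<Rightarrow> (nat \<Rightarrow> nat \<Rightarrow> nat) \<Rightarrow> nat list" where
  "sigma_T n lam T =
     (let S = scanning_tableau n lam T; d = length (zetas n lam) in
      concat [ sorted_list_of_set (vals_of_len n lam S (zeta n lam h)
                                   - vals_of_len n lam S (zeta n lam (h - 1))).
               h \<leftarrow> [1..<Suc d] ]
      @ sorted_list_of_set ({1..n} - colSet n lam S 1))"

text \<open>Chain of (0-indexed) positions i_1, i_2, ... starting from position p, where
  i_x is the smallest position >= c (i.e. 1-indexed > c_j) with
  pi_(i_(x-1)) < pi_(i_x) <= t; stops once the value t is reached. Values strictly increase
  along the chain, so length pi steps of fuel always suffice.\<close>
fun greedy_chain :: "nat list \<Rightarrow> nat \<Rightarrow> nat \<Rightarrow> nat \<Rightarrow> nat \<Rightarrow> nat list" where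
  "greedy_chain pi c t p 0 = []"
| "greedy_chain pi c t p (Suc f) =
     (if t \<le> pi ! p then []
      else (let q = (LEAST q. c \<le> q \<and> q < length pi \<and> pi ! p < pi ! q \<and> pi ! q \<le> t)
            in q # greedy_chain pi c t q f))"

text \<open>One nontrivial step: i0 is the 0-indexed position i - 1, c = c_j, t = T(j,i).
  New entries: position i_x gets pi_(i_(x-1)) (x = 1..m), position i_0 gets pi_(i_m).\<close>
definition greedy_step :: "nat list \<Rightarrow> nat \<Rightarrow> nat \<Rightarrow> nat \<Rightarrow> nat list" where
  "greedy_step pi c i0 t =
     (let idx = i0 # greedy_chain pi c t i0 (length pi) in
      foldl (\<lambda>acc x. acc[idx ! x := pi ! (idx ! (x - 1))])
            (pi[i0 := pi ! last idx]) [1..<length idx])"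

definition greedy_init :: "nat \<Rightarrow> (nat \<Rightarrow> nat) \<Rightarrow> (nat \<Rightarrow> nat \<Rightarrow> nat) \<Rightarrow> nat list" where
  "greedy_init n lam T =
     sorted_list_of_set (colSet n lam T 1) @ sorted_list_of_set ({1..n} - colSet n lam T 1)"

definition greedy_locs :: "nat \<Rightarrow> (nat \<Rightarrow> nat) \<Rightarrow> (nat \<times> nat) list" where
  "greedy_locs n lam = [(j, i). j \<leftarrow> [2..<Suc (lam 1)], i \<leftarrow> rev [1..<Suc (colLen n lam j)]]"

definition pi_T :: "nat \<Rightarrow> (nat \<Rightarrow> nat) \<Rightarrow> (nat \<Rightarrow> nat \<Rightarrow> nat) \<Rightarrow> nat list" where
  "pi_T n lam T =
     foldl (\<lambda>pi (j, i). if T (j - 1) i = T j i then pi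
                        else greedy_step pi (colLen n lam j) (i - 1) (T j i))
           (greedy_init n lam T) (greedy_locs n lam)"

end

(*
  Both procedures change sets by one operation: replacing the largest element not exceeding x
  by x. On the scanning side, all scans started in column l can be run through the later columns
  one column at a time, since the end values only depend on how many boxes of each column are
  already used; so column l of S(T), as a set, arises from column l of T by these replacements
  with x running through the entries of the later columns in reading order. On the greedy side,
  one step is a bubble pass through the positions beyond c_j, and for every k >= c_j it changes
  the set of the first k entries of the permutation by the replacement with x = T(j,i). Hence
  the first c_l entries of pi_T form column l of S(T). A bubble pass also keeps every sorted
  segment beyond c_j sorted, so pi_T is increasing on the blocks that define sigma_T.
*)
theory Submission
  imports Defs
begin

section \<open>Replacing the largest element below a bound\<close>

text \<open>The \<open>else\<close> branch makes the operation total, so that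
  \<open>set_absorb\<close> needs no hypothesis comparing the entries of the two lists.\<close>

definition replace_le :: "nat set \<Rightarrow> nat \<Rightarrow> nat set" where
  "replace_le A x = (if \<exists>a\<in>A. a \<le> x then insert x (A - {Max {a \<in> A. a \<le> x}}) else A)"

text \<open>An element above \<open>x\<close> is never the one replaced. Hence, when values are
  treated in decreasing order, those above everything still to come are settled and can be split
  off.\<close>

lemma replace_le_insert_greater:
  assumes "x < b"
  shows "replace_le (insert b A) x = insert b (replace_le A x)"
proof -
  have eq: "{a \<in> insert b A. a \<le> x} = {a \<in> A. a \<le> x}"
    using assms by auto
  show ?thesis
  proof (cases "\<exists>a\<in>A. a \<le> x")
    case True
    have fin: "finite {a \<in> A. a \<le> x}"
      by (rule finite_subset[of _ "{..x}"]) auto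
    have "Max {a \<in> A. a \<le> x} \<in> {a \<in> A. a \<le> x}"
      using Max_in[OF fin] True by blast
    then have "b \<noteq> Max {a \<in> A. a \<le> x}"
      using assms by auto
    then show ?thesis
      using True eq by (auto simp: replace_le_def)
  next
    case False
    then show ?thesis
      using assms by (auto simp: replace_le_def)
  qed
qed

lemma foldl_replace_le_insert_greater:
  assumes "\<forall>x\<in>set xs. x < b"
  shows "foldl replace_le (insert b A) xs = insert b (foldl replace_le A xs)"
  using assms by (induction xs arbitrary: A) (simp_all add: replace_le_insert_greater)

lemma replace_le_insert_le:
  assumes "v \<le> x" "\<forall>a\<in>A. a < v"
  shows "replace_le (insert v A) x = insert x A"
proof -
  have "{a \<in> insert v A. a \<le> x} = insert v A"
    using assms by auto
  moreover have "Max (insert v A) = v"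
    using assms by (intro Max_eqI) (auto intro: finite_subset[of _ "{..<v}"])
  moreover have "v \<notin> A"
    using assms by auto
  ultimately show ?thesis
    using assms by (auto simp: replace_le_def)
qed

lemma replace_le_mem:
  assumes "x \<in> A"
  shows "replace_le A x = A"
proof -
  have "Max {a \<in> A. a \<le> x} = x"
    using assms by (intro Max_eqI) (auto intro: finite_subset[of _ "{..x}"])
  then show ?thesis
    using assms by (auto simp: replace_le_def)
qed

section \<open>Scanning column by column\<close>

text \<open>The first list holds the current values of the scans in the order in which they are run,
  the second the remaining entries of one column from the bottom up. Each scan is offered only the
  lowest remaining entry; if it declines, the next scan is offered the same one.\<close>

fun absorb :: "nat list \<Rightarrow> nat list \<Rightarrow> nat list" where
  "absorb [] c = []"
| "absorb (v # vs) [] = v # vs"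
| "absorb (v # vs) (x # xs) = (if v \<le> x then x # absorb vs xs else v # absorb vs (x # xs))"

lemma absorb_Nil2 [simp]: "absorb vs [] = vs"
  by (cases vs) auto

lemma absorb_less:
  assumes "\<forall>v\<in>set vs. v < b" "\<forall>x\<in>set c. x < b"
  shows "\<forall>y\<in>set (absorb vs c). y < b"
  using assms by (induction vs c rule: absorb.induct) auto

lemma sorted_wrt_absorb:
  assumes "sorted_wrt (>) vs" "sorted_wrt (>) c"
  shows "sorted_wrt (>) (absorb vs c)"
  using assms
proof (induction vs c rule: absorb.induct)
  case (3 v vs x xs)
  show ?case
  proof (cases "v \<le> x")
    case True
    have "\<forall>w\<in>set vs. w < x"
      using True 3(3) by auto
    then have "\<forall>y\<in>set (absorb vs xs). y < x"
      using 3(4) by (intro absorb_less) auto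
    then show ?thesis
      using True 3 by auto
  next
    case False
    then have "\<forall>y\<in>set (absorb vs (x # xs)). y < v"
      using 3(3,4) by (intro absorb_less) auto
    then show ?thesis
      using False 3 by auto
  qed
qed auto

text \<open>\<open>absorb\<close> proceeds scan by scan, the fold entry by entry. If
  \<open>v \<le> x\<close>, then \<open>v\<close> is the largest value and is replaced, and
  \<open>x\<close> lies above all that remains; if \<open>x < v\<close>, then \<open>v\<close>
  itself lies above all remaining entries. Either way the head is settled and splits off.\<close>

lemma set_absorb:
  assumes "sorted_wrt (>) vs" "sorted_wrt (>) c"
  shows "set (absorb vs c) = foldl replace_le (set vs) c"
  using assms
proof (induction vs c rule: absorb.induct)
  case (1 c)
  then show ?case
    \<comment> \<open>The empty set is fixed by every replacement.\<close>
    by (induction c) (auto simp: replace_le_def)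
next
  case (3 v vs x xs)
  show ?case
  proof (cases "v \<le> x")
    case True
    have "replace_le (set (v # vs)) x = insert x (set vs)"
      using True 3(3) by (simp add: replace_le_insert_le)
    then have "foldl replace_le (set (v # vs)) (x # xs) = insert x (foldl replace_le (set vs) xs)"
      using 3(4) by (simp add: foldl_replace_le_insert_greater)
    then show ?thesis
      using True 3 by auto
  next
    case False
    then have "foldl replace_le (set (v # vs)) (x # xs)
        = insert v (foldl replace_le (set vs) (x # xs))"
      using 3(4) unfolding list.set(2) by (intro foldl_replace_le_insert_greater) auto
    then show ?thesis
      using False 3 by simp
  qed
qed auto

lemma set_foldl_absorb:
  assumes "sorted_wrt (>) vs" "\<forall>c\<in>set cs. sorted_wrt (>) c"
  shows "set (foldl absorb vs cs) = foldl replace_le (set vs) (concat cs)"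
  using assms
  by (induction cs arbitrary: vs) (auto simp: sorted_wrt_absorb set_absorb)

text \<open>Returns the end value together with what is left of the columns. Columns are listed from
  the bottom up, so deleting a box of the path removes the head of a list.\<close>

fun scan :: "nat \<Rightarrow> nat list list \<Rightarrow> nat \<times> nat list list" where
  "scan v [] = (v, [])"
| "scan v ([] # cs) = (let (w, cs') = scan v cs in (w, [] # cs'))"
| "scan v ((x # xs) # cs) =
     (if v \<le> x then (let (w, cs') = scan x cs in (w, xs # cs'))
      else (let (w, cs') = scan v cs in (w, (x # xs) # cs')))"

fun multi_scan :: "nat list \<Rightarrow> nat list list \<Rightarrow> nat list" where
  "multi_scan [] cs = []"
| "multi_scan (v # vs) cs = (let (w, cs') = scan v cs in w # multi_scan vs cs')"

lemma multi_scan_Nil2 [simp]: "multi_scan vs [] = vs"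
  by (induction vs) auto

text \<open>What a scan does in column \<open>c\<close> depends only on its value and on what
  earlier scans left of \<open>c\<close>, never on later columns. All passages through
  \<open>c\<close> can therefore be made first.\<close>

lemma multi_scan_Cons: "multi_scan vs (c # cs) = multi_scan (absorb vs c) cs"
proof (induction vs arbitrary: c cs)
  case (Cons v vs)
  \<comment> \<open>An exhausted column changes no scan; this is the induction hypothesis for the
    empty column.\<close>
  have Nil_case: "multi_scan vs ([] # ds) = multi_scan vs ds" for ds
    using Cons[of "[]" ds] by simp
  show ?case
    by (cases c) (auto simp: Cons Nil_case split: prod.splits)
qed auto

text \<open>Running all scans through one column before moving on to the next column
  gives the same end values as running the scans one after the other.\<close>
lemma multi_scan_eq_foldl_absorb: "multi_scan vs cs = foldl absorb vs cs"
  by (induction cs arbitrary: vs) (simp_all add: multi_scan_Cons)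

section \<open>The scanning tableau\<close>

definition slice :: "(nat \<times> nat) set \<Rightarrow> nat \<Rightarrow> nat set" where
  "slice D l = {i. (l, i) \<in> D}"

definition column_list :: "(nat \<Rightarrow> nat \<Rightarrow> nat) \<Rightarrow> (nat \<times> nat) set \<Rightarrow> nat \<Rightarrow> nat list" where
  "column_list T D l = map (T l) (rev (sorted_list_of_set (slice D l)))"

text \<open>The sequence inside \<open>scan_path\<close>, with an arbitrary list of columns to allow
  induction on it.\<close>

definition lowest_boxes ::
  "(nat \<Rightarrow> nat \<Rightarrow> nat) \<Rightarrow> (nat \<times> nat) set \<Rightarrow> nat list \<Rightarrow> ((nat \<times> nat) \<times> nat) list" where
  "lowest_boxes T D ls =
     [((l, Max {i. (l, i) \<in> D}), T l (Max {i. (l, i) \<in> D})). l \<leftarrow> ls, {i. (l, i) \<in> D} \<noteq> {}]"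

lemma rev_sorted_list_of_set_Max:
  fixes A :: "nat set"
  assumes "finite A" "A \<noteq> {}"
  shows "rev (sorted_list_of_set A) = Max A # rev (sorted_list_of_set (A - {Max A}))"
proof -
  have "sorted_list_of_set A = sorted_list_of_set (A - {Max A}) @ [Max A]"
    using assms by (intro sorted_distinct_set_unique) (auto simp: sorted_append insert_absorb)
  then show ?thesis
    by simp
qed

text \<open>Passes from paths of locations to scans of values: in each visited column the path takes
  the lowest box, which is the head of that column's list. Here \<open>b\<close> is the last
  location so far, so \<open>last (b # p)\<close> is the end of the path even when \<open>p\<close>
  is empty.\<close>

lemma scan_column_lists:
  assumes "distinct ls" "\<forall>l\<in>set ls. finite (slice D l)" "case_prod T b = v"
    and p: "p = ewis_aux v (lowest_boxes T D ls)"
  shows "fst ` set p \<subseteq> set ls"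
    and "scan v (map (column_list T D) ls)
      = (case_prod T (last (b # p)), map (column_list T (D - set p)) ls)"
proof -
  have "fst ` set p \<subseteq> set ls \<and> scan v (map (column_list T D) ls)
      = (case_prod T (last (b # p)), map (column_list T (D - set p)) ls)"
    using assms
  proof (induction ls arbitrary: v b p)
    case Nil
    then show ?case
      by (auto simp: lowest_boxes_def)
  next
    case (Cons l ls)
    let ?A = "slice D l"
    let ?hit = "?A \<noteq> {} \<and> v \<le> T l (Max ?A)"
    \<comment> \<open>The last location and its value after column \<open>l\<close> has been
      offered.\<close>
    define b' where "b' = (if ?hit then (l, Max ?A) else b)"
    define v' where "v' = (if ?hit then T l (Max ?A) else v)"
    define p' where "p' = ewis_aux v' (lowest_boxes T D ls)"
    have p_eq: "p = (if ?hit then (l, Max ?A) # p' else p')"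
      using Cons.prems(4) by (auto simp: p'_def v'_def lowest_boxes_def slice_def)
    have "case_prod T b' = v'"
      using Cons.prems(3) by (simp add: b'_def v'_def)
    then have IH: "fst ` set p' \<subseteq> set ls" "scan v' (map (column_list T D) ls)
      = (case_prod T (last (b' # p')), map (column_list T (D - set p')) ls)"
      using Cons.IH[of b' v' p'] Cons.prems(1,2) by (auto simp: p'_def)
    have l: "l \<notin> set ls"
      using Cons.prems(1) by simp
    then have "l \<notin> fst ` set p'"
      using IH(1) by blast
    \<comment> \<open>The rest of the path stays in the columns \<open>ls\<close>, so column
      \<open>l\<close> loses at most its lowest box.\<close>
    then have slice_l: "slice (D - set p) l = (if ?hit then ?A - {Max ?A} else ?A)"
      by (auto simp: slice_def p_eq rev_image_eqI)
    have "slice (D - set p) k = slice (D - set p') k" if "k \<in> set ls" for k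
      using that l by (auto simp: slice_def p_eq)
    then have slices: "map (column_list T (D - set p)) ls = map (column_list T (D - set p')) ls"
      by (simp add: column_list_def)
    have fin: "finite ?A"
      using Cons.prems(2) by simp
    have last: "last (b # p) = last (b' # p')"
      by (simp add: p_eq b'_def)
    have "scan v (map (column_list T D) (l # ls))
      = (fst (scan v' (map (column_list T D) ls)),
         column_list T (D - set p) l # snd (scan v' (map (column_list T D) ls)))"
    proof (cases "?A = {}")
      case True
      then show ?thesis
        using slice_l by (auto simp: column_list_def v'_def split: prod.splits)
    next
      case False
      have "column_list T D l = T l (Max ?A) # map (T l) (rev (sorted_list_of_set (?A - {Max ?A})))"
        using rev_sorted_list_of_set_Max[OF fin False] by (simp add: column_list_def)
      then show ?thesis
        using slice_l False by (auto simp: column_list_def v'_def split: prod.splits)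
    qed
    then have "scan v (map (column_list T D) (l # ls))
      = (case_prod T (last (b # p)), map (column_list T (D - set p)) (l # ls))"
      using IH(2) slices last by simp
    moreover have "fst ` set p \<subseteq> set (l # ls)"
      using IH(1) by (auto simp: p_eq)
    ultimately show ?case
      by blast
  qed
  then show "fst ` set p \<subseteq> set ls" "scan v (map (column_list T D) ls)
      = (case_prod T (last (b # p)), map (column_list T (D - set p)) ls)"
    by blast+
qed

lemma length_col_paths: "length (col_paths lam T j m D) = m"
  by (induction m arbitrary: D) (auto simp: Let_def)

text \<open>Later columns of \<open>D\<close> may be any finite sets. The condition on column
  \<open>j\<close> survives the deletion of a path, since the path meets that column only in its
  lowest box, row \<open>m\<close>.\<close>

lemma col_paths_eq_multi_scan:
  assumes "j \<le> lam 1" "\<forall>l. finite (slice D l)" "slice D j = {1..m}"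
  shows "map (\<lambda>p. case_prod T (last p)) (col_paths lam T j m D)
    = multi_scan (map (T j) (rev [1..<Suc m])) (map (column_list T D) [Suc j..<Suc (lam 1)])"
  using assms
proof (induction m arbitrary: D)
  case (Suc m)
  define p where "p = ewis_aux (T j (Suc m)) (lowest_boxes T D [Suc j..<Suc (lam 1)])"
  have col: "{i. (j, i) \<in> D} = {1..Suc m}"
    using Suc.prems(3) by (simp only: slice_def)
  moreover from col have "(j, Suc m) \<in> D"
    by (metis atLeastAtMost_iff le_add1 le_refl mem_Collect_eq plus_1_eq_Suc)
  moreover have "Max {1..Suc m} = Suc m"
    by (intro Max_eqI) auto
  moreover have "[j..<Suc (lam 1)] = j # [Suc j..<Suc (lam 1)]"
    using Suc.prems(1) by (simp add: upt_rec)
  ultimately have path: "scan_path lam T j D = (j, Suc m) # p"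
    by (auto simp: scan_path_def p_def lowest_boxes_def simp del: upt_Suc)
  have p: "fst ` set p \<subseteq> set [Suc j..<Suc (lam 1)]"
      "scan (T j (Suc m)) (map (column_list T D) [Suc j..<Suc (lam 1)])
       = (case_prod T (last ((j, Suc m) # p)), map (column_list T (D - set p)) [Suc j..<Suc (lam 1)])"
    using scan_column_lists[where b = "(j, Suc m)", OF distinct_upt _ _ p_def] Suc.prems(2)
    by (auto simp del: upt_Suc)
  let ?D = "D - set ((j, Suc m) # p)"
  have "(j, i) \<notin> set p" for i
  proof
    assume "(j, i) \<in> set p"
    then have "j \<in> set [Suc j..<Suc (lam 1)]"
      using p(1) by (metis fst_conv image_eqI subsetD)
    then show False
      by (simp del: upt_Suc)
  qed
  then have "slice ?D j = slice D j - {Suc m}"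
    by (auto simp: slice_def)
  moreover have "{1..Suc m} - {Suc m} = {1..m}"
    by auto
  ultimately have slice_j: "slice ?D j = {1..m}"
    using Suc.prems(3) by (simp only:)
  have fin: "\<forall>l. finite (slice ?D l)"
    using Suc.prems(2) by (auto simp: slice_def intro: rev_finite_subset)
  have cols: "map (column_list T ?D) [Suc j..<Suc (lam 1)]
      = map (column_list T (D - set p)) [Suc j..<Suc (lam 1)]"
    by (auto simp: column_list_def slice_def simp del: upt_Suc)
  have "map (\<lambda>p. case_prod T (last p)) (col_paths lam T j (Suc m) D)
    = case_prod T (last ((j, Suc m) # p))
      # map (\<lambda>p. case_prod T (last p)) (col_paths lam T j m ?D)"
    by (simp add: path Let_def)
  also have "\<dots> = multi_scan (T j (Suc m) # map (T j) (rev [1..<Suc m]))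
      (map (column_list T D) [Suc j..<Suc (lam 1)])"
    using Suc.IH[OF Suc.prems(1) fin slice_j] unfolding cols
    by (simp only: multi_scan.simps p(2) Let_def prod.case)
  finally show ?case
    by simp
qed simp

section \<open>The greedy step as a bubble pass\<close>

text \<open>\<open>u\<close> is the value in hand; every entry in the interval from \<open>u\<close>
  (excluded) to \<open>t\<close> (included) is exchanged for it. Once \<open>t\<close> is in hand
  nothing more changes.\<close>

fun bubble :: "nat \<Rightarrow> nat \<Rightarrow> nat list \<Rightarrow> nat list" where
  "bubble u t [] = []"
| "bubble u t (x # xs) = (if u < x \<and> x \<le> t then u # bubble x t xs else x # bubble u t xs)"

lemma length_bubble [simp]: "length (bubble u t xs) = length xs"
  by (induction xs arbitrary: u) auto

lemma take_bubble: "take k (bubble u t xs) = bubble u t (take k xs)"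
  by (induction xs arbitrary: u k) (auto simp: take_Cons split: nat.splits)

text \<open>The remainder of a pass is again a pass, with whatever value is in hand at the cut.
  Later uses need only that such a value exists.\<close>

lemma bubble_append: "\<exists>w. bubble u t (xs @ ys) = bubble u t xs @ bubble w t ys"
  by (induction xs arbitrary: u) auto

lemma bubble_skip:
  assumes "\<forall>x\<in>set xs. \<not> (u < x \<and> x \<le> t)"
  shows "bubble u t (xs @ ys) = xs @ bubble u t ys"
  using assms by (induction xs) auto

lemma bubble_id:
  assumes "\<forall>x\<in>set xs. \<not> (u < x \<and> x \<le> t)"
  shows "bubble u t xs = xs"
  using bubble_skip[OF assms, of "[]"] by simp

lemma set_bubble_subset: "set (bubble u t xs) \<subseteq> insert u (set xs)"
proof (induction xs arbitrary: u)
  case (Cons x xs)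
  show ?case
    using Cons[of u] Cons[of x] by auto
qed simp

text \<open>In a sorted list the exchanged entries form a contiguous run. The pass puts
  \<open>u\<close> in front of this run and drops its last entry, which keeps the order.\<close>

lemma sorted_bubble:
  assumes "sorted xs"
  shows "sorted (bubble u t xs)"
  using assms
proof (induction xs arbitrary: u)
  case (Cons x xs)
  consider "u < x" "x \<le> t" | "t < x" | "x \<le> u"
    by linarith
  then show ?case
  proof cases
    case 1
    then show ?thesis
      using Cons set_bubble_subset[of x t xs] by fastforce
  next
    case 2
    then have "bubble u t (x # xs) = x # xs"
      using Cons.prems by (intro bubble_id) auto
    then show ?thesis
      using Cons.prems by simp
  next
    case 3
    then show ?thesis
      using Cons set_bubble_subset[of u t xs] by fastforce
  qed
qed simp

text \<open>The value in hand is always the largest value not exceeding \<open>t\<close> met so far,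
  \<open>u\<close> included; the one in hand at the end is not put back. Distinctness turns the loss
  of one occurrence into removal from the set.\<close>

lemma set_bubble:
  assumes "distinct (u # xs)" "u \<le> t"
  shows "set (bubble u t xs) = insert u (set xs) - {Max {a \<in> insert u (set xs). a \<le> t}}"
  using assms
proof (induction xs arbitrary: u)
  case Nil
  have "{a. a = u \<and> a \<le> t} = {u}"
    using Nil by auto
  then show ?case
    by simp
next
  case (Cons x xs)
  let ?M = "\<lambda>A. Max {a \<in> A. a \<le> t}"
  show ?case
  proof (cases "u < x \<and> x \<le> t")
    case True
    have IH: "set (bubble x t xs) = insert x (set xs) - {?M (insert x (set xs))}"
      using Cons.IH[of x] Cons.prems True by auto
    have ge: "x \<le> ?M (insert x (set xs))"
      using True by (intro Max_ge) auto
    have eq: "{a \<in> insert u (set (x # xs)). a \<le> t} = insert u {a \<in> insert x (set xs). a \<le> t}"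
      using Cons.prems by auto
    have "?M (insert u (set (x # xs))) = max u (?M (insert x (set xs)))"
      unfolding eq using True by (intro Max_insert) auto
    then have M: "?M (insert u (set (x # xs))) = ?M (insert x (set xs))"
      using ge True by linarith
    have "u \<noteq> ?M (insert x (set xs))"
      using ge True by linarith
    moreover have "u \<notin> insert x (set xs)" "bubble u t (x # xs) = u # bubble x t xs"
      using True Cons.prems by auto
    ultimately show ?thesis
      unfolding M using IH by force
  next
    case False
    have IH: "set (bubble u t xs) = insert u (set xs) - {?M (insert u (set xs))}"
      using Cons.IH[of u] Cons.prems by auto
    have mem: "?M (insert u (set xs)) \<in> {a \<in> insert u (set xs). a \<le> t}"
      using Cons.prems by (intro Max_in) auto
    have ge: "u \<le> ?M (insert u (set xs))"
      using Cons.prems by (intro Max_ge) auto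
    have M: "?M (insert u (set (x # xs))) = ?M (insert u (set xs))"
    proof (cases "x \<le> t")
      case True
      then have eq: "{a \<in> insert u (set (x # xs)). a \<le> t} = insert x {a \<in> insert u (set xs). a \<le> t}"
        by auto
      have "?M (insert u (set (x # xs))) = max x (?M (insert u (set xs)))"
        unfolding eq using Cons.prems by (intro Max_insert) auto
      then show ?thesis
        using ge True False by linarith
    next
      case False
      then have "{a \<in> insert u (set (x # xs)). a \<le> t} = {a \<in> insert u (set xs). a \<le> t}"
        by auto
      then show ?thesis
        by simp
    qed
    have "x \<notin> insert u (set xs)" "bubble u t (x # xs) = x # bubble u t xs"
      using False Cons.prems by auto
    moreover from this have "x \<noteq> ?M (insert u (set xs))"
      using mem by blast
    ultimately show ?thesis
      unfolding M using IH by force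
  qed
qed

text \<open>The value carried out of the pass over \<open>ys\<close> is the largest value not exceeding \<open>t\<close>
  in \<open>xs @ ys\<close>, because it started as the largest such value in \<open>xs\<close>.\<close>
lemma set_update_append_bubble:
  assumes dist: "distinct (xs @ ys)" and i: "i < length xs" and le: "xs ! i \<le> t"
    and max: "\<forall>a\<in>set xs. a \<le> t \<longrightarrow> a \<le> xs ! i"
  shows "set (xs[i := t] @ bubble (xs ! i) t ys) = replace_le (set (xs @ ys)) t"
proof -
  let ?u = "xs ! i"
  let ?B = "{a \<in> insert ?u (set ys). a \<le> t}"
  define M where "M = Max ?B"
  have u: "?u \<in> set xs"
    using i by simp
  have "M \<in> ?B"
    unfolding M_def using le by (intro Max_in) auto
  then have M: "M \<in> insert ?u (set ys)" "M \<le> t"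
    by auto
  have B_le: "a \<le> M" if "a \<in> ?B" for a
    unfolding M_def using that by (intro Max_ge) auto
  have "a \<le> M" if "a \<in> set xs" "a \<le> t" for a
    using max that B_le[of ?u] le by fastforce
  then have "Max {a \<in> set (xs @ ys). a \<le> t} = M"
    using M u B_le by (intro Max_eqI) auto
  then have rhs: "replace_le (set (xs @ ys)) t = insert t (set (xs @ ys) - {M})"
    using u le by (auto simp: replace_le_def)
  have "set (bubble ?u t ys) = insert ?u (set ys) - {M}"
    unfolding M_def using dist u le by (intro set_bubble) auto
  moreover have "set (xs[i := t]) = insert t (set xs - {?u})"
    using dist i by (simp add: set_update_distinct)
  moreover have "M \<notin> set xs - {?u}" "?u \<notin> set ys"
    using M(1) dist u by auto
  ultimately show ?thesis
    unfolding rhs using u by auto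
qed

text \<open>The write loop of \<open>greedy_step\<close> as a recursion along the index chain:
  values are read from the original \<open>xs\<close> and written into \<open>acc\<close>.\<close>

fun shift_along :: "nat list \<Rightarrow> nat \<Rightarrow> nat list \<Rightarrow> nat list \<Rightarrow> nat list" where
  "shift_along xs p [] acc = acc"
| "shift_along xs p (q # qs) acc = shift_along xs q qs (acc[q := xs ! p])"

lemma foldl_eq_shift_along:
  "foldl (\<lambda>acc x. acc[(p # qs) ! x := xs ! ((p # qs) ! (x - 1))]) acc [1..<length (p # qs)]
    = shift_along xs p qs acc"
proof (induction qs arbitrary: p acc)
  case (Cons q qs)
  have upt: "[1..<length (p # q # qs)] = 1 # map Suc [1..<length (q # qs)]"
    by (simp add: map_Suc_upt upt_conv_Cons del: upt_Suc)
  have "foldl (\<lambda>acc x. acc[(p # q # qs) ! x := xs ! ((p # q # qs) ! (x - 1))]) acc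
      [1..<length (p # q # qs)]
    = foldl (\<lambda>acc x. acc[(q # qs) ! x := xs ! ((q # qs) ! (x - 1))]) (acc[q := xs ! p])
      [1..<length (q # qs)]"
    unfolding upt foldl_Cons foldl_map
    by (rule foldl_cong) (auto simp: nth_Cons' simp del: upt_Suc)
  then show ?case
    using Cons[of q] by simp
qed simp

text \<open>\<open>s\<close> marks the part already passed. The chain always searches from
  \<open>c\<close>, but no position in between qualifies, so the search effectively starts at
  \<open>s\<close>, where \<open>acc\<close> still agrees with \<open>xs\<close>. The unpassed
  length bounds the fuel needed, and the presence of \<open>t\<close> makes the chain end
  there.\<close>

lemma shift_along_greedy_chain:
  assumes "\<forall>r. c \<le> r \<and> r < s \<longrightarrow> \<not> (xs ! p < xs ! r \<and> xs ! r \<le> t)"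
    and "c \<le> s" "s \<le> length xs" "xs ! p \<le> t" "t \<in> set (xs ! p # drop s xs)"
    and "length xs - s \<le> f" "length acc = length xs" "drop s acc = drop s xs"
  shows "shift_along xs p (greedy_chain xs c t p f) acc = take s acc @ bubble (xs ! p) t (drop s xs)
    \<and> xs ! last (p # greedy_chain xs c t p f) = t"
  using assms
proof (induction f arbitrary: p s acc)
  \<comment> \<open>Without fuel, \<open>s = length xs\<close>, so the only place left for
    \<open>t\<close> is \<open>xs ! p\<close>.\<close>
  case 0
  then show ?case
    by auto
next
  case (Suc f)
  show ?case
  proof (cases "xs ! p = t")
    case True
    have "take s acc @ drop s xs = acc"
      using Suc.prems(8) by (metis append_take_drop_id)
    then show ?thesis
      using True by (simp add: bubble_id)
  next
    case False
    let ?P = "\<lambda>q. c \<le> q \<and> q < length xs \<and> xs ! p < xs ! q \<and> xs ! q \<le> t"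
    define q where "q = (LEAST q. ?P q)"
    have lt: "xs ! p < t"
      using False Suc.prems(4) by simp
    then have "t \<in> set (drop s xs)"
      using Suc.prems(5) by auto
    then obtain k where k: "s + k < length xs" "xs ! (s + k) = t"
      using Suc.prems(3) by (metis in_set_conv_nth length_drop less_diff_conv add.commute nth_drop)
    then have Pk: "?P (s + k)"
      using Suc.prems(2) lt by simp
    have q: "?P q"
      unfolding q_def by (rule LeastI[where P = ?P, OF Pk])
    have least: "\<not> ?P r" if "r < q" for r
      using not_less_Least[of r ?P] that unfolding q_def by blast
    have sq: "s \<le> q"
      using q Suc.prems(1) by (meson not_less)
    have qk: "q \<le> s + k"
      unfolding q_def by (rule Least_le[where P = ?P, OF Pk])
    have len: "q < length xs"
      using q by simp
    let ?mid = "take (q - s) (drop s xs)"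
    have split: "drop s xs = ?mid @ xs ! q # drop (Suc q) xs"
      using sq len by (metis Cons_nth_drop_Suc append_take_drop_id drop_drop le_add_diff_inverse2)
    have "\<forall>x\<in>set ?mid. \<not> (xs ! p < x \<and> x \<le> t)"
    proof
      fix x
      assume "x \<in> set ?mid"
      then obtain r where "r < q - s" "s + r < length xs" "x = xs ! (s + r)"
        by (auto simp: in_set_conv_nth)
      then show "\<not> (xs ! p < x \<and> x \<le> t)"
        using least[of "s + r"] Suc.prems(2) by auto
    qed
    then have bub: "bubble (xs ! p) t (drop s xs)
        = ?mid @ xs ! p # bubble (xs ! q) t (drop (Suc q) xs)"
      using q by (subst split, subst bubble_skip) auto
    let ?acc = "acc[q := xs ! p]"
    have "drop (Suc q) acc = drop (Suc q) xs"
    proof -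
      have "drop (Suc q - s) (drop s acc) = drop (Suc q - s) (drop s xs)"
        using Suc.prems(8) by simp
      then show ?thesis
        using sq by simp
    qed
    then have acc: "drop (Suc q) ?acc = drop (Suc q) xs"
      by simp
    have t_in: "t \<in> set (xs ! q # drop (Suc q) xs)"
    proof (cases "q = s + k")
      case False
      then have "xs ! (s + k) \<in> set (drop (Suc q) xs)"
        using qk k(1) nth_drop[of "Suc q" xs "s + k - Suc q"]
          nth_mem[of "s + k - Suc q" "drop (Suc q) xs"] by (simp del: add_Suc)
      then show ?thesis
        using k(2) by simp
    qed (use k in simp)
    \<comment> \<open>The interval of admissible values shrinks when \<open>xs ! p\<close> is
      replaced by the larger \<open>xs ! q\<close>, so positions rejected before stay
      rejected.\<close>
    have none: "\<forall>r. c \<le> r \<and> r < Suc q \<longrightarrow> \<not> (xs ! q < xs ! r \<and> xs ! r \<le> t)"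
    proof (intro allI impI)
      fix r
      assume r: "c \<le> r \<and> r < Suc q"
      show "\<not> (xs ! q < xs ! r \<and> xs ! r \<le> t)"
        using r least[of r] q by (cases "r = q") auto
    qed
    have IH: "shift_along xs q (greedy_chain xs c t q f) ?acc
        = take (Suc q) ?acc @ bubble (xs ! q) t (drop (Suc q) xs)
        \<and> xs ! last (q # greedy_chain xs c t q f) = t"
      by (rule Suc.IH[OF none _ _ _ t_in _ _ acc]) (use q sq Suc.prems in auto)
    have chain: "greedy_chain xs c t p (Suc f) = q # greedy_chain xs c t q f"
      using lt by (simp add: q_def Let_def)
    have "take (q - s) (drop s acc) = ?mid"
      using Suc.prems(8) by simp
    then have "take q acc = take s acc @ ?mid"
      using sq by (metis le_add_diff_inverse take_add)
    then have "take (Suc q) ?acc = take s acc @ ?mid @ [xs ! p]"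
      using len Suc.prems(7) by (simp add: take_Suc_conv_app_nth)
    then show ?thesis
      using IH bub chain by simp
  qed
qed

lemma greedy_step_eq_bubble:
  assumes "i < c" "c \<le> length xs" "xs ! i < t" "t \<in> set (drop c xs)"
  shows "greedy_step xs c i t = (take c xs)[i := t] @ bubble (xs ! i) t (drop c xs)"
proof -
  let ?ch = "greedy_chain xs c t i (length xs)"
  have "shift_along xs i ?ch acc = take c acc @ bubble (xs ! i) t (drop c xs)
      \<and> xs ! last (i # ?ch) = t" if "length acc = length xs" "drop c acc = drop c xs" for acc
    by (rule shift_along_greedy_chain) (use assms that in auto)
  \<comment> \<open>Since the chain ends at value \<open>t\<close>, the accumulator with which
    \<open>greedy_step\<close> starts is \<open>xs[i := t]\<close>.\<close>
  from this[of xs] this[of "xs[i := t]"]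
  have "xs ! last (i # ?ch) = t"
      "shift_along xs i ?ch (xs[i := t]) = (take c xs)[i := t] @ bubble (xs ! i) t (drop c xs)"
    using assms by (auto simp: take_update_swap)
  then show ?thesis
    unfolding greedy_step_def Let_def by (simp only: foldl_eq_shift_along)
qed

text \<open>Beyond position \<open>c\<close> the step is a bubble pass, and its part from
  \<open>p\<close> on is again one, so \<open>sorted_bubble\<close> applies to the segment.\<close>

lemma segment_greedy_step:
  assumes "i < c" "c \<le> length xs" "xs ! i < t" "t \<in> set (drop c xs)"
    and "c \<le> p" "sorted (take m (drop p xs))"
  shows "sorted (take m (drop p (greedy_step xs c i t)))"
proof -
  let ?ys = "drop c xs"
  obtain w where w: "bubble (xs ! i) t (take (p - c) ?ys @ drop (p - c) ?ys)
      = bubble (xs ! i) t (take (p - c) ?ys) @ bubble w t (drop (p - c) ?ys)"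
    using bubble_append by blast
  have "drop p (greedy_step xs c i t) = drop (p - c) (bubble (xs ! i) t ?ys)"
    using assms by (simp add: greedy_step_eq_bubble)
  also have "\<dots> = drop (p - c) (bubble (xs ! i) t (take (p - c) ?ys) @ bubble w t (drop (p - c) ?ys))"
    using w by (simp only: append_take_drop_id)
  also have "\<dots> = bubble w t (drop p xs)"
    using assms(2,5) by (cases "p \<le> length xs") auto
  finally have "drop p (greedy_step xs c i t) = bubble w t (drop p xs)" .
  then show ?thesis
    using assms(6) by (simp add: take_bubble sorted_bubble)
qed

section \<open>Column sets and prefix sets\<close>

lemma foldl_concat_map: "foldl f a (concat (map g xs)) = foldl (\<lambda>a x. foldl f a (g x)) a xs"
  by (induction xs arbitrary: a) auto

lemma sorted_segmentI:
  fixes xs :: "nat list"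
  assumes "q \<le> length xs" "\<And>r s. p \<le> r \<Longrightarrow> r < s \<Longrightarrow> s < q \<Longrightarrow> xs ! r \<le> xs ! s"
  shows "sorted (take (q - p) (drop p xs))"
  using assms by (auto simp: sorted_iff_nth_mono_less)

locale ssyt =
  fixes n :: nat and lam :: "nat \<Rightarrow> nat" and T :: "nat \<Rightarrow> nat \<Rightarrow> nat"
  assumes partition: "is_npartition n lam"
    and semistd: "semistandard n lam T"
begin

section \<open>Shape of the diagram and inequalities between entries\<close>

abbreviation c :: "nat \<Rightarrow> nat" where
  "c \<equiv> colLen n lam"

lemma lam_antimono:
  assumes "1 \<le> i" "i \<le> k" "k \<le> n"
  shows "lam k \<le> lam i"
  using assms(2,3)
proof (induction k rule: dec_induct)
  case (step k)
  then have "lam (Suc k) \<le> lam k"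
    using partition assms(1) by (simp add: is_npartition_def)
  then show ?case
    using step by simp
qed simp

text \<open>\<open>colLen\<close> is a cardinality. As row lengths decrease weakly, the rows counted
  form an initial interval, so the count is also the last row of the column.\<close>

lemma rows_eq: "{i \<in> {1..n}. j \<le> lam i} = {1..c j}"
proof -
  let ?A = "{i \<in> {1..n}. j \<le> lam i}"
  have "\<exists>m. ?A = {1..m}"
  proof (cases "?A = {}")
    case False
    have "finite ?A"
      by simp
    then obtain m where m: "m \<in> ?A" "\<forall>i\<in>?A. i \<le> m"
      using Max_in[OF _ False] Max_ge[of ?A] by (meson that)
    have "i \<in> ?A" if "1 \<le> i" "i \<le> m" for i
      using that m(1) lam_antimono[of i m] by auto
    then have "{1..m} \<subseteq> ?A"
      by (meson atLeastAtMost_iff subsetI)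
    moreover have "?A \<subseteq> {1..m}"
      using m(2) by auto
    ultimately show ?thesis
      by blast
  qed (auto intro: exI[of _ 0])
  then obtain m where m: "?A = {1..m}"
    by blast
  then have "c j = m"
    unfolding colLen_def by simp
  then show ?thesis
    using m by (simp only:)
qed

lemma in_boxes_iff:
  assumes "1 \<le> j"
  shows "(j, i) \<in> boxes n lam \<longleftrightarrow> 1 \<le> i \<and> i \<le> c j"
  using assms rows_eq[of j] by (auto simp: boxes_def set_eq_iff)

lemma c_le: "c j \<le> n"
  unfolding colLen_def by (rule order_trans[OF card_mono[of "{1..n}"]]) auto

lemma c_antimono: "j \<le> k \<Longrightarrow> c k \<le> c j"
  unfolding colLen_def by (rule card_mono) auto

lemma entry_range: "1 \<le> j \<Longrightarrow> 1 \<le> i \<Longrightarrow> i \<le> c j \<Longrightarrow> T j i \<in> {1..n}"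
  using semistd in_boxes_iff[of j i] unfolding semistandard_def by blast

lemma row_le:
  assumes "2 \<le> j" "1 \<le> i" "i \<le> c j"
  shows "T (j - 1) i \<le> T j i"
proof -
  have "(j - 1, i) \<in> boxes n lam" "(Suc (j - 1), i) \<in> boxes n lam"
    using assms c_antimono[of "j - 1" j] by (auto simp: in_boxes_iff)
  then have "T (j - 1) i \<le> T (Suc (j - 1)) i"
    using semistd unfolding semistandard_def by blast
  then show ?thesis
    using assms by simp
qed

lemma column_less:
  assumes "1 \<le> j" "1 \<le> i" "i < k" "k \<le> c j"
  shows "T j i < T j k"
proof -
  have step: "T j r < T j (Suc r)" if "i \<le> r" "r < k" for r
  proof -
    have "(j, r) \<in> boxes n lam" "(j, Suc r) \<in> boxes n lam"
      using that assms by (auto simp: in_boxes_iff)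
    then show ?thesis
      using semistd unfolding semistandard_def by blast
  qed
  show ?thesis
    by (rule lift_Suc_mono_less_ivl[of "{i..<k}" "T j"])
      (use assms(3) in \<open>auto intro: step\<close>)
qed

section \<open>Columns in reading order, and the column sets of the scanning tableau\<close>

definition column :: "nat \<Rightarrow> nat list" where
  "column j = map (T j) (rev [1..<Suc (c j)])"

lemma set_column: "set (column j) = colSet n lam T j"
  by (auto simp: column_def colSet_def simp del: upt_Suc)

lemma sorted_wrt_column:
  assumes "1 \<le> j"
  shows "sorted_wrt (>) (column j)"
proof -
  have "sorted_wrt (\<lambda>a b. T j b > T j a) [1..<Suc (c j)]"
    using assms by (auto simp: sorted_wrt_iff_nth_less simp del: upt_Suc intro!: column_less)
  then show ?thesis
    by (simp add: column_def sorted_wrt_map sorted_wrt_rev del: upt_Suc)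
qed

lemma slice_boxes: "1 \<le> j \<Longrightarrow> slice (boxes n lam) j = {1..c j}"
  by (auto simp: slice_def in_boxes_iff)

lemma column_list_boxes:
  assumes "1 \<le> j"
  shows "column_list T (boxes n lam) j = column j"
proof -
  have "sorted_list_of_set {1..c j} = [1..<Suc (c j)]"
    by (metis atLeastLessThanSuc_atLeastAtMost sorted_list_of_set_range)
  then show ?thesis
    using assms by (simp only: column_list_def slice_boxes column_def)
qed

text \<open>The end values of the paths from column \<open>j\<close> are those of the successive
  scans, which can be run column by column; each column then acts by replacements with its entries
  from the bottom up, so altogether in reading order.\<close>

lemma colSet_scanning_tableau:
  assumes "1 \<le> j" "j \<le> lam 1"
  shows "colSet n lam (scanning_tableau n lam T) j
    = foldl replace_le (set (column j)) (concat (map column [Suc j..<Suc (lam 1)]))"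
proof -
  let ?ps = "col_paths lam T j (c j) (boxes n lam)"
  let ?val = "\<lambda>p. case_prod T (last p)"
  have entry: "scanning_tableau n lam T j i = ?val (?ps ! (c j - i))" for i
    by (simp add: scanning_tableau_def scanning_path_def)
  have "colSet n lam (scanning_tableau n lam T) j = (\<lambda>k. ?val (?ps ! k)) ` {..<c j}"
  proof (intro equalityI subsetI)
    fix x
    assume "x \<in> colSet n lam (scanning_tableau n lam T) j"
    then obtain i where "1 \<le> i" "i \<le> c j" "x = ?val (?ps ! (c j - i))"
      unfolding colSet_def entry by blast
    then show "x \<in> (\<lambda>k. ?val (?ps ! k)) ` {..<c j}"
      by (intro image_eqI[of _ _ "c j - i"]) auto
  next
    fix x
    assume "x \<in> (\<lambda>k. ?val (?ps ! k)) ` {..<c j}"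
    then obtain k where k: "k < c j" "x = ?val (?ps ! k)"
      by blast
    \<comment> \<open>The list of paths starts with the bottom row, so index \<open>k\<close>
      belongs to row \<open>c j - k\<close>.\<close>
    then have "x = ?val (?ps ! (c j - (c j - k)))" "1 \<le> c j - k" "c j - k \<le> c j"
      by auto
    then show "x \<in> colSet n lam (scanning_tableau n lam T) j"
      unfolding colSet_def entry by blast
  qed
  also have "\<dots> = set (map ?val ?ps)"
    using length_col_paths[of lam T j "c j" "boxes n lam"] by (force simp: set_conv_nth)
  also have "map ?val ?ps = multi_scan (map (T j) (rev [1..<Suc (c j)]))
      (map (column_list T (boxes n lam)) [Suc j..<Suc (lam 1)])"
  proof (rule col_paths_eq_multi_scan)
    show "\<forall>l. finite (slice (boxes n lam) l)"
      by (auto simp: slice_def boxes_def intro: finite_subset[of _ "{..n}"])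
  qed (use assms slice_boxes in auto)
  also have "map (T j) (rev [1..<Suc (c j)]) = column j"
    by (simp only: column_def)
  also have "map (column_list T (boxes n lam)) [Suc j..<Suc (lam 1)]
      = map column [Suc j..<Suc (lam 1)]"
    by (auto simp: column_list_boxes simp del: upt_Suc)
  also have "set (multi_scan (column j) (map column [Suc j..<Suc (lam 1)]))
      = foldl replace_le (set (column j)) (concat (map column [Suc j..<Suc (lam 1)]))"
    unfolding multi_scan_eq_foldl_absorb
    using assms(1) by (intro set_foldl_absorb) (auto simp: sorted_wrt_column simp del: upt_Suc)
  finally show ?thesis .
qed

section \<open>The greedy procedure: one step, one column, all columns\<close>

definition greedy_at :: "nat \<Rightarrow> nat list \<Rightarrow> nat \<Rightarrow> nat list" where
  "greedy_at j xs i =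
     (if T (j - 1) i = T j i then xs else greedy_step xs (c j) (i - 1) (T j i))"

definition greedy_column :: "nat list \<Rightarrow> nat \<Rightarrow> nat list" where
  "greedy_column xs j = foldl (greedy_at j) xs (rev [1..<Suc (c j)])"

lemma pi_T_eq_foldl_greedy_column:
  "pi_T n lam T = foldl greedy_column (greedy_init n lam T) [2..<Suc (lam 1)]"
  unfolding pi_T_def greedy_locs_def foldl_concat_map greedy_column_def greedy_at_def foldl_map
  by (simp del: upt_Suc)

text \<open>The state of the greedy procedure when rows \<open>i, \<dots>, c j\<close> of column \<open>j\<close> are done.\<close>
definition greedy_state :: "nat \<Rightarrow> nat \<Rightarrow> nat list \<Rightarrow> bool" where
  "greedy_state j i xs \<longleftrightarrow> distinct xs \<and> set xs = {1..n} \<and>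
     (\<forall>r<c j. xs ! r = (if i \<le> Suc r then T j (Suc r) else T (j - 1) (Suc r)))"

lemma greedy_state_length: "greedy_state j i xs \<Longrightarrow> length xs = n"
  unfolding greedy_state_def by (metis card_atLeastAtMost diff_Suc_1 distinct_card)

lemma greedy_at_step:
  assumes "2 \<le> j" "1 \<le> i" "i \<le> c j" and st: "greedy_state j (Suc i) xs"
  shows "greedy_state j i (greedy_at j xs i)"
    and "\<And>k. c j \<le> k \<Longrightarrow> set (take k (greedy_at j xs i)) = replace_le (set (take k xs)) (T j i)"
    and "\<And>p m. c j \<le> p \<Longrightarrow> sorted (take m (drop p xs))
      \<Longrightarrow> sorted (take m (drop p (greedy_at j xs i)))"
proof -
  let ?t = "T j i"
  have dist: "distinct xs" and set_xs: "set xs = {1..n}"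
    and nth: "\<And>r. r < c j \<Longrightarrow>
      xs ! r = (if Suc i \<le> Suc r then T j (Suc r) else T (j - 1) (Suc r))"
    using st by (auto simp: greedy_state_def)
  have len: "length xs = n"
    using st by (rule greedy_state_length)
  have i': "i - 1 < c j" "Suc (i - 1) = i"
    using assms by auto
  have cn: "c j \<le> n" "c j \<le> c (j - 1)"
    by (auto intro: c_le c_antimono)
  have u: "xs ! (i - 1) = T (j - 1) i"
    using nth[OF i'(1)] i' by simp
  have "greedy_state j i (greedy_at j xs i) \<and>
    (\<forall>k\<ge>c j. set (take k (greedy_at j xs i)) = replace_le (set (take k xs)) ?t) \<and>
    (\<forall>p m. c j \<le> p \<longrightarrow> sorted (take m (drop p xs))
      \<longrightarrow> sorted (take m (drop p (greedy_at j xs i))))"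
  proof (cases "T (j - 1) i = ?t")
    case True
    then have eq: "greedy_at j xs i = xs"
      by (simp add: greedy_at_def)
    \<comment> \<open>With equal neighbours, \<open>T j i\<close> already occupies position
      \<open>i - 1\<close>, so the replacement has no effect.\<close>
    have "?t \<in> set (take k xs)" if "c j \<le> k" for k
    proof -
      have "take k xs ! (i - 1) = ?t" "i - 1 < length (take k xs)"
        using that i' u True len cn by auto
      then show ?thesis
        by (metis nth_mem)
    qed
    moreover have "xs ! r = (if i \<le> Suc r then T j (Suc r) else T (j - 1) (Suc r))"
      if "r < c j" for r
      using nth[OF that] True by (cases "Suc r = i") auto
    ultimately show ?thesis
      using dist set_xs unfolding eq greedy_state_def by (simp add: replace_le_mem)
  next
    case False
    then have lt: "T (j - 1) i < ?t"
      using row_le[OF assms(1-3)] by simp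
    \<comment> \<open>Position \<open>i - 1\<close> holds the largest admissible value of the first
      \<open>c j\<close> positions: lower rows already carry entries of column \<open>j\<close>
      above \<open>T j i\<close>, higher rows still carry entries of column \<open>j - 1\<close>
      below \<open>T (j - 1) i\<close>.\<close>
    have prefix: "a \<le> T (j - 1) i \<or> ?t < a" if a: "a \<in> set (take (c j) xs)" for a
    proof -
      obtain r where r: "r < c j" "a = xs ! r"
        using a by (auto simp: in_set_conv_nth)
      consider "Suc i \<le> Suc r" | "Suc r = i" | "Suc r < i"
        by linarith
      then show ?thesis
      proof cases
        case 1
        then show ?thesis
          using r nth[OF r(1)] assms column_less[of j i "Suc r"] by auto
      next
        case 2
        then show ?thesis
          using r nth[OF r(1)] by simp
      next
        case 3
        moreover have "1 \<le> j - 1"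
          using assms by linarith
        ultimately show ?thesis
          using r nth[OF r(1)] assms cn column_less[of "j - 1" "Suc r" i] by simp
      qed
    qed
    have "?t \<in> set xs"
      using entry_range[of j i] assms set_xs by simp
    moreover have "?t \<notin> set (take (c j) xs)"
      using prefix[of ?t] lt by auto
    ultimately have t_in: "?t \<in> set (drop (c j) xs)"
      by (metis Un_iff append_take_drop_id set_append)
    have hyps: "i - 1 < c j" "c j \<le> length xs" "xs ! (i - 1) < ?t"
      using i' cn len u lt by auto
    have at: "greedy_at j xs i = greedy_step xs (c j) (i - 1) ?t"
      using False by (simp add: greedy_at_def)
    have step: "greedy_at j xs i
        = (take (c j) xs)[i - 1 := ?t] @ bubble (xs ! (i - 1)) ?t (drop (c j) xs)"
      unfolding at by (rule greedy_step_eq_bubble[OF hyps t_in])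
    have sets: "set (take k (greedy_at j xs i)) = replace_le (set (take k xs)) ?t"
      if k: "c j \<le> k" for k
    proof -
      let ?X = "take (c j) xs" and ?Y = "take (k - c j) (drop (c j) xs)"
      have XY: "?X @ ?Y = take k xs"
        using k by (metis le_add_diff_inverse take_add)
      have Xi: "?X ! (i - 1) = xs ! (i - 1)"
        using i' by simp
      have "take k (greedy_at j xs i) = ?X[i - 1 := ?t] @ bubble (?X ! (i - 1)) ?t ?Y"
        unfolding step Xi using k hyps(2) by (simp add: take_bubble)
      also have "set \<dots> = replace_le (set (?X @ ?Y)) ?t"
      proof (rule set_update_append_bubble)
        show "distinct (?X @ ?Y)"
          unfolding XY using dist by simp
        show "\<forall>a\<in>set ?X. a \<le> ?t \<longrightarrow> a \<le> ?X ! (i - 1)"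
          unfolding Xi u using prefix by fastforce
      qed (use hyps Xi in auto)
      finally show ?thesis
        by (simp only: XY)
    qed
    have len': "length (greedy_at j xs i) = n"
      unfolding step using len hyps(2) by simp
    \<comment> \<open>For the full prefix the replacement is trivial, because \<open>T j i\<close>
      occurs somewhere in \<open>xs\<close>. The unchanged set and length then give
      distinctness.\<close>
    have "set (greedy_at j xs i) = replace_le (set xs) ?t"
      using sets[of n] cn len len' by simp
    then have set': "set (greedy_at j xs i) = {1..n}"
      using \<open>?t \<in> set xs\<close> set_xs by (simp add: replace_le_mem)
    then have "distinct (greedy_at j xs i)"
      using len' by (intro card_distinct) simp
    moreover have "greedy_at j xs i ! r = (if i \<le> Suc r then T j (Suc r) else T (j - 1) (Suc r))"
      if r: "r < c j" for r
    proof (cases "r = i - 1")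
      case True
      then show ?thesis
        unfolding step using r i' hyps(2) by (simp add: nth_append)
    next
      case False
      then have "greedy_at j xs i ! r = xs ! r"
        unfolding step using r hyps(2) by (simp add: nth_append)
      then show ?thesis
        using nth[OF r] False by auto
    qed
    ultimately have "greedy_state j i (greedy_at j xs i)"
      using set' by (simp add: greedy_state_def)
    then show ?thesis
      using sets segment_greedy_step[OF hyps t_in] by (simp add: at)
  qed
  then show "greedy_state j i (greedy_at j xs i)"
    "\<And>k. c j \<le> k \<Longrightarrow> set (take k (greedy_at j xs i)) = replace_le (set (take k xs)) ?t"
    "\<And>p m. c j \<le> p \<Longrightarrow> sorted (take m (drop p xs))
      \<Longrightarrow> sorted (take m (drop p (greedy_at j xs i)))"
    by blast+
qed

lemma foldl_greedy_at:
  assumes "2 \<le> j" "m \<le> c j" "greedy_state j (Suc m) xs"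
  shows "greedy_state j 1 (foldl (greedy_at j) xs (rev [1..<Suc m])) \<and>
    (\<forall>k\<ge>c j. set (take k (foldl (greedy_at j) xs (rev [1..<Suc m])))
      = foldl replace_le (set (take k xs)) (map (T j) (rev [1..<Suc m]))) \<and>
    (\<forall>p l. c j \<le> p \<longrightarrow> sorted (take l (drop p xs))
      \<longrightarrow> sorted (take l (drop p (foldl (greedy_at j) xs (rev [1..<Suc m])))))"
  using assms(2,3)
proof (induction m arbitrary: xs)
  case (Suc m)
  have rev: "rev [1..<Suc (Suc m)] = Suc m # rev [1..<Suc m]"
    by simp
  have m: "1 \<le> Suc m" "m \<le> c j"
    using Suc.prems(1) by auto
  note step = greedy_at_step[OF assms(1) m(1) Suc.prems]
  note IH = Suc.IH[OF m(2) step(1)]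
  show ?case
    unfolding rev foldl_Cons list.map
  proof (intro conjI allI impI)
    fix k
    assume "c j \<le> k"
    then show "set (take k (foldl (greedy_at j) (greedy_at j xs (Suc m)) (rev [1..<Suc m])))
      = foldl replace_le (replace_le (set (take k xs)) (T j (Suc m))) (map (T j) (rev [1..<Suc m]))"
      using IH step(2)[of k] by metis
  qed (use IH step(3) in blast)+
qed (use assms(1) in simp)

text \<open>The invariant after column \<open>j\<close>. Sortedness is asked of every segment
  without a column length strictly inside, which avoids naming the distinct lengths, whose set grows
  with \<open>j\<close>. For \<open>j = lam 1\<close> the last clause describes the columns of the
  scanning tableau.\<close>

definition column_state :: "nat \<Rightarrow> nat list \<Rightarrow> bool" where
  "column_state j xs \<longleftrightarrow> distinct xs \<and> set xs = {1..n} \<and>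
     (\<forall>r<c j. xs ! r = T j (Suc r)) \<and>
     (\<forall>p q. q \<le> n \<longrightarrow> (\<forall>l\<in>{1..j}. \<not> (p < c l \<and> c l < q)) \<longrightarrow> sorted (take (q - p) (drop p xs))) \<and>
     (\<forall>l\<in>{1..j}. set (take (c l) xs)
        = foldl replace_le (set (column l)) (concat (map column [Suc l..<Suc j])))"

lemma sorted_column_segment:
  assumes "length xs = n" "1 \<le> j" "\<And>r. r < c j \<Longrightarrow> xs ! r = T j (Suc r)" "q \<le> c j"
  shows "sorted (take (q - p) (drop p xs))"
proof (rule sorted_segmentI)
  show "q \<le> length xs"
    using assms(1,4) c_le[of j] by simp
  fix r s
  assume "p \<le> r" "r < s" "s < q"
  then show "xs ! r \<le> xs ! s"
    using assms column_less[of j "Suc r" "Suc s"] by simp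
qed

lemma set_take_column:
  assumes "length xs = n" "\<And>r. r < c j \<Longrightarrow> xs ! r = T j (Suc r)"
  shows "set (take (c j) xs) = set (column j)"
proof -
  have "take (c j) xs = map (T j) [1..<Suc (c j)]"
    using assms c_le[of j] by (intro nth_equalityI) (auto simp del: upt_Suc)
  then show ?thesis
    by (simp only: column_def set_map set_rev)
qed

lemma column_state_Suc:
  assumes "1 \<le> j" and st: "column_state j xs"
  shows "column_state (Suc j) (greedy_column xs (Suc j))"
proof -
  let ?ys = "greedy_column xs (Suc j)"
  have nth: "\<And>r. r < c j \<Longrightarrow> xs ! r = T j (Suc r)"
    and seg: "\<And>p q. q \<le> n \<Longrightarrow> (\<forall>l\<in>{1..j}. \<not> (p < c l \<and> c l < q))
      \<Longrightarrow> sorted (take (q - p) (drop p xs))"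
    and pre: "\<And>l. l \<in> {1..j} \<Longrightarrow> set (take (c l) xs)
      = foldl replace_le (set (column l)) (concat (map column [Suc l..<Suc j]))"
    using st unfolding column_state_def by blast+
  have cc: "c (Suc j) \<le> c j"
    by (simp add: c_antimono)
  \<comment> \<open>No row of the new column has been treated yet, so the first positions still
    carry column \<open>j\<close>.\<close>
  have "greedy_state (Suc j) (Suc (c (Suc j))) xs"
    using st nth cc by (simp add: greedy_state_def column_state_def)
  from foldl_greedy_at[OF _ le_refl this] assms(1)
  have gs: "greedy_state (Suc j) 1 ?ys"
    and sets: "\<And>k. c (Suc j) \<le> k \<Longrightarrow>
      set (take k ?ys) = foldl replace_le (set (take k xs)) (column (Suc j))"
    and segs: "\<And>p l. c (Suc j) \<le> p \<Longrightarrow> sorted (take l (drop p xs))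
      \<Longrightarrow> sorted (take l (drop p ?ys))"
    unfolding greedy_column_def column_def by (simp_all del: upt_Suc)
  have len: "length ?ys = n"
    using gs by (rule greedy_state_length)
  have nth': "?ys ! r = T (Suc j) (Suc r)" if "r < c (Suc j)" for r
    using gs that by (simp add: greedy_state_def)
  \<comment> \<open>A segment starting at \<open>c (Suc j)\<close> or later stays sorted under the
    step. One starting earlier must end by \<open>c (Suc j)\<close>, which is now a cut, and so lies
    within the strictly increasing new column.\<close>
  have seg': "sorted (take (q - p) (drop p ?ys))"
    if "q \<le> n" "\<forall>l\<in>{1..Suc j}. \<not> (p < c l \<and> c l < q)" for p q
  proof (cases "c (Suc j) \<le> p")
    case True
    then show ?thesis
      using that by (intro segs seg) auto
  next
    case False
    then have "q \<le> c (Suc j)"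
      using that(2) assms(1) by (auto simp: not_less)
    then show ?thesis
      using len nth' by (intro sorted_column_segment[where j = "Suc j"]) auto
  qed
  have pre': "set (take (c l) ?ys)
      = foldl replace_le (set (column l)) (concat (map column [Suc l..<Suc (Suc j)]))"
    if l: "l \<in> {1..Suc j}" for l
  proof (cases "l = Suc j")
    case True
    then show ?thesis
      using set_take_column[OF len nth'] by simp
  next
    case False
    then have lj: "l \<in> {1..j}"
      using l by auto
    then have "[Suc l..<Suc (Suc j)] = [Suc l..<Suc j] @ [Suc j]"
      by simp
    \<comment> \<open>The prefix of length \<open>c l\<close> is at least as long as the new column,
      so the new entries act on it by replacement.\<close>
    then show ?thesis
      using sets[of "c l"] pre[OF lj] lj c_antimono[of l "Suc j"] by (simp del: upt_Suc)
  qed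
  show ?thesis
    unfolding column_state_def
    using gs nth' seg' pre' unfolding greedy_state_def by blast
qed

text \<open>The initial permutation consists of two sorted blocks, and the only cut so far,
  \<open>c 1\<close>, lies between them.\<close>

lemma column_state_init: "column_state 1 (greedy_init n lam T)"
proof -
  let ?xs = "greedy_init n lam T"
  let ?C = "colSet n lam T 1"
  have C: "?C \<subseteq> {1..n}"
    using entry_range[of 1] unfolding colSet_def by blast
  then have fin: "finite ?C"
    by (rule finite_subset) simp
  have "sorted (map (T 1) [1..<Suc (c 1)])"
    using column_less[of 1] by (auto simp: sorted_iff_nth_mono_less simp del: upt_Suc intro!: less_imp_le)
  moreover have "distinct (map (T 1) [1..<Suc (c 1)])"
    using sorted_wrt_column[of 1] unfolding column_def
    by (metis distinct_rev rev_map le_refl strict_sorted_iff sorted_wrt_rev rev_rev_ident)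
  moreover have "set (map (T 1) [1..<Suc (c 1)]) = ?C"
    using set_column[of 1] by (simp only: column_def set_map set_rev)
  ultimately have init: "sorted_list_of_set ?C = map (T 1) [1..<Suc (c 1)]"
    by (intro sorted_distinct_set_unique) (use fin in auto)
  have set: "set ?xs = {1..n}"
    using C fin by (auto simp: greedy_init_def)
  have dist: "distinct ?xs"
    using C fin by (auto simp: greedy_init_def)
  have len: "length ?xs = n"
    using set dist by (metis card_atLeastAtMost diff_Suc_1 distinct_card)
  have nth: "?xs ! r = T 1 (Suc r)" if "r < c 1" for r
    using that unfolding greedy_init_def init by (simp add: nth_append del: upt_Suc)
  have drop: "drop (c 1) ?xs = sorted_list_of_set ({1..n} - ?C)"
    unfolding greedy_init_def init by (simp del: upt_Suc)
  have seg: "sorted (take (q - p) (drop p ?xs))"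
    if q: "q \<le> n" "\<forall>l\<in>{1..1}. \<not> (p < c l \<and> c l < q)" for p q
  proof (cases "c 1 \<le> p")
    case True
    then have "drop p ?xs = drop (p - c 1) (drop (c 1) ?xs)"
      by simp
    then show ?thesis
      unfolding drop by (metis sorted_wrt_take sorted_wrt_drop sorted_list_of_set.sorted_sorted_key_list_of_set)
  next
    case False
    then have "q \<le> c 1"
      using q by auto
    then show ?thesis
      using len nth by (intro sorted_column_segment[where j = 1]) auto
  qed
  have pre: "set (take (c l) ?xs)
      = foldl replace_le (set (column l)) (concat (map column [Suc l..<Suc 1]))" if "l \<in> {1..1}" for l
    using that set_take_column[OF len nth] by simp
  show ?thesis
    unfolding column_state_def using set dist nth seg pre by blast
qed

lemma column_state_pi_T:
  assumes "1 \<le> lam 1"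
  shows "column_state (lam 1) (pi_T n lam T)"
proof -
  have "column_state j (foldl greedy_column (greedy_init n lam T) [2..<Suc j])" if "1 \<le> j" for j
    using that
  proof (induction j rule: dec_induct)
    case base
    then show ?case
      using column_state_init by simp
  next
    case (step j)
    then show ?case
      using column_state_Suc[of j] by simp
  qed
  then show ?thesis
    using assms unfolding pi_T_eq_foldl_greedy_column by blast
qed

section \<open>The distinct column lengths and the blocks of \<open>sigma_T\<close>\<close>

lemma set_zetas: "set (zetas n lam) = c ` {1..lam 1}"
proof -
  have "{c j |j. 1 \<le> j \<and> j \<le> lam 1} = c ` {1..lam 1}"
    by auto
  then show ?thesis
    by (simp add: zetas_def)
qed

lemma zetas_nth_less:
  assumes "a < b" "b < length (zetas n lam)"
  shows "zetas n lam ! a < zetas n lam ! b"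
proof -
  have "sorted_wrt (<) (zetas n lam)"
    by (simp add: zetas_def)
  then show ?thesis
    using assms by (rule sorted_wrt_nth_less)
qed

lemma zetas_nth_mono:
  assumes "a \<le> b" "b < length (zetas n lam)"
  shows "zetas n lam ! a \<le> zetas n lam ! b"
  using assms by (intro sorted_nth_mono) (simp_all add: zetas_def)

lemma zeta_in:
  assumes "1 \<le> h" "h \<le> length (zetas n lam)"
  shows "zeta n lam h \<in> c ` {1..lam 1}"
  using assms unfolding set_zetas[symmetric] zeta_def by simp

lemma zeta_mono:
  assumes "h < length (zetas n lam)"
  shows "zeta n lam h \<le> zeta n lam (Suc h)"
  using assms zetas_nth_mono[of "h - 1" h] by (simp add: zeta_def)

lemma zeta_gap:
  assumes "h < length (zetas n lam)" "l \<in> {1..lam 1}"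
  shows "\<not> (zeta n lam h < c l \<and> c l < zeta n lam (Suc h))"
proof -
  obtain x where x: "x < length (zetas n lam)" "c l = zetas n lam ! x"
    using assms(2) set_zetas by (metis image_eqI in_set_conv_nth)
  \<comment> \<open>Entry \<open>x\<close> of the 0-indexed list is
    \<open>zeta n lam (Suc x)\<close>, so \<open>x < h\<close> places \<open>c l\<close> at or below
    the lower bound and \<open>h \<le> x\<close> at or above the upper one.\<close>
  consider "x < h" | "x = h" | "h < x"
    by linarith
  then show ?thesis
  proof cases
    case 1
    then have "c l \<le> zeta n lam h"
      using assms(1) x(2) zetas_nth_mono[of x "h - 1"] by (simp add: zeta_def)
    then show ?thesis
      by simp
  next
    case 2
    then show ?thesis
      using x by (simp add: zeta_def)
  next
    case 3
    then show ?thesis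
      using x zetas_nth_less[of h x] by (simp add: zeta_def)
  qed
qed

lemma zeta_last:
  assumes "1 \<le> lam 1"
  shows "zeta n lam (length (zetas n lam)) = c 1"
proof -
  let ?d = "length (zetas n lam)"
  have "c 1 \<in> set (zetas n lam)"
    unfolding set_zetas using assms by auto
  then obtain x where x: "x < ?d" "c 1 = zetas n lam ! x"
    by (metis in_set_conv_nth)
  then have "c 1 \<le> zeta n lam ?d"
    using zetas_nth_mono[of x "?d - 1"] by (auto simp: zeta_def)
  moreover have "zeta n lam ?d \<in> c ` {1..lam 1}"
    using x by (intro zeta_in) auto
  then have "zeta n lam ?d \<le> c 1"
    by (auto intro: c_antimono)
  ultimately show ?thesis
    by simp
qed

text \<open>Each block of \<open>sigma_T\<close> is the sorted difference of two prefix sets of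
  \<open>pi_T\<close>. The segment between these prefixes has the same set and is already sorted, so
  the two lists coincide.\<close>

theorem pi_T_eq_sigma_T:
  assumes lam1: "1 \<le> lam 1"
  shows "pi_T n lam T = sigma_T n lam T"
proof -
  define xs where "xs = pi_T n lam T"
  let ?S = "scanning_tableau n lam T"
  let ?d = "length (zetas n lam)"
  let ?z = "zeta n lam"
  let ?V = "\<lambda>h. vals_of_len n lam ?S (?z h)"
  have "column_state (lam 1) xs"
    using lam1 unfolding xs_def by (rule column_state_pi_T)
  then have dist: "distinct xs" and set: "set xs = {1..n}"
    and seg: "\<And>p q. q \<le> n \<Longrightarrow> (\<forall>l\<in>{1..lam 1}. \<not> (p < c l \<and> c l < q))
      \<Longrightarrow> sorted (take (q - p) (drop p xs))"
    and pre: "\<And>l. l \<in> {1..lam 1} \<Longrightarrow> set (take (c l) xs) = colSet n lam ?S l"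
    unfolding column_state_def using colSet_scanning_tableau by auto
  have len: "length xs = n"
    using dist set by (metis card_atLeastAtMost diff_Suc_1 distinct_card)
  have block: "sorted_list_of_set (set (take q xs) - set (take p xs)) = take (q - p) (drop p xs)"
    if "p \<le> q" "q \<le> n" "\<forall>l\<in>{1..lam 1}. \<not> (p < c l \<and> c l < q)" for p q
  proof -
    have "take q xs = take p xs @ take (q - p) (drop p xs)"
      using that(1) by (metis le_add_diff_inverse take_add)
    moreover have "distinct (take q xs)"
      using dist by simp
    ultimately have "set (take q xs) - set (take p xs) = set (take (q - p) (drop p xs))"
      by (metis Diff_cancel Un_Diff Un_Diff_Int distinct_append inf_commute set_append sup_bot_left Diff_triv)
    then show ?thesis
      using dist seg[OF that(2,3)] by (intro sorted_distinct_set_unique) auto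
  qed
  \<comment> \<open>Columns of equal length in the scanning tableau have the same set, namely that
    of one prefix, so the union collapses. For \<open>h = 0\<close> both sides are empty.\<close>
  have V: "?V h = set (take (?z h) xs)" if h: "h \<le> ?d" for h
  proof (cases "h = 0")
    case True
    have "?V h = {}"
      unfolding vals_of_len_def colSet_def zeta_def using True by auto
    then show ?thesis
      using True by (simp add: zeta_def)
  next
    case False
    then obtain l where l: "l \<in> {1..lam 1}" "?z h = c l"
      using zeta_in[of h] h by auto
    have "colSet n lam ?S j = set (take (c l) xs)" if "1 \<le> j" "j \<le> lam 1" "c j = c l" for j
      using pre[of j] that by auto
    then have "?V h = (\<Union>j\<in>{j. 1 \<le> j \<and> j \<le> lam 1 \<and> c j = c l}. set (take (c l) xs))"
      unfolding vals_of_len_def l(2) by (intro SUP_cong) simp_all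
    then show ?thesis
      using l by auto
  qed
  have "concat (map (\<lambda>h. sorted_list_of_set (?V h - ?V (h - 1))) [1..<Suc k]) = take (?z k) xs"
    if "k \<le> ?d" for k
    using that
  proof (induction k)
    case 0
    then show ?case
      by (simp add: zeta_def)
  next
    case (Suc k)
    have "?z (Suc k) \<in> c ` {1..lam 1}"
      using Suc.prems by (intro zeta_in) auto
    then have le: "?z (Suc k) \<le> n"
      using c_le by auto
    have mono: "?z k \<le> ?z (Suc k)"
      using Suc.prems by (intro zeta_mono) auto
    have "sorted_list_of_set (?V (Suc k) - ?V k) = take (?z (Suc k) - ?z k) (drop (?z k) xs)"
      using Suc.prems le mono zeta_gap[of k] by (simp add: V block)
    moreover have "take (?z (Suc k)) xs
        = take (?z k) xs @ take (?z (Suc k) - ?z k) (drop (?z k) xs)"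
      using mono by (metis le_add_diff_inverse take_add)
    ultimately show ?case
      using Suc.IH Suc.prems by simp
  qed
  from this[of ?d]
  have "concat (map (\<lambda>h. sorted_list_of_set (?V h - ?V (h - 1))) [1..<Suc ?d]) = take (c 1) xs"
    using zeta_last[OF lam1] by simp
  \<comment> \<open>The final block is the segment from \<open>c 1\<close> to \<open>n\<close>; no
    column is longer than the first, so nothing cuts it.\<close>
  moreover have "sorted_list_of_set ({1..n} - colSet n lam ?S 1) = drop (c 1) xs"
  proof -
    have "c l \<le> c 1" if "l \<in> {1..lam 1}" for l
      using that by (intro c_antimono) auto
    then have "sorted_list_of_set (set (take n xs) - set (take (c 1) xs))
        = take (n - c 1) (drop (c 1) xs)"
      using c_le[of 1] by (intro block) (auto simp: not_less)
    then show ?thesis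
      using pre[of 1] lam1 set len by simp
  qed
  ultimately have "sigma_T n lam T = take (c 1) xs @ drop (c 1) xs"
    unfolding sigma_T_def Let_def by (simp del: upt_Suc append_take_drop_id)
  then show ?thesis
    by (simp add: xs_def)
qed

end

theorem theorem5p4:
  fixes n :: nat and lam :: "nat \<Rightarrow> nat" and T :: "nat \<Rightarrow> nat \<Rightarrow> nat"
  assumes "1 \<le> n"
    and "is_npartition n lam"
    and "lam n = 0"
    and "\<exists>i \<in> {1..n}. lam i \<noteq> 0"
    and "semistandard n lam T"
  shows "pi_T n lam T = sigma_T n lam T"
proof -
  interpret ssyt n lam T
    using assms by unfold_locales
  \<comment> \<open>A nonempty row forces the first row, the longest, to be nonempty.\<close>
  obtain i where i: "i \<in> {1..n}" "lam i \<noteq> 0"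
    using assms(4) by blast
  then have "lam i \<le> lam 1"
    by (intro lam_antimono) auto
  then show ?thesis
    using i(2) by (intro pi_T_eq_sigma_T) simp
qed

end
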